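(* Let $n\ge 1$ and $\omega\in\mathfrak S_n$. For every acyclic pipe dream $P\in\mathrm{APD}(\omega)$ the set $\mathcal L(P)$ is non-empty, the sets $\mathcal L(P)$ for distinct $P\in\mathrm{APD}(\omega)$ are pairwise disjoint, and $\bigcup_{P\in\mathrm{APD}(\omega)}\mathcal L(P)=[e,\omega]$. That is, $\{\mathcal L(P) : P\in\mathrm{APD}(\omega)\}$ is a partition of the weak order interval $[e,\omega]$.
   Context: Permutations of $[n]=\{1,\dots,n\}$ are written in one-line notation $\pi=\pi(1)\pi(2)\cdots\pi(n)$. An inversion of $\pi$ is a pair of values $i<j$ with $\pi^{-1}(i)>\pi^{-1}(j)$. The weak order on $\mathfrak S_n$ is defined by $\pi\le\sigma$ if and only if every inversion of $\pi$ is an inversion of $\sigma$; $e$ is the identity and $[e,\omega]=\{\pi:\pi\le\omega\}$. Pipe dreams: consider the triangular shape of grid positions $(r,c)$ (row $r$ counted from the top, column $c$ from the left) with $r,c\ge1$ and $r+c\le n+1$. A pipe dream is a filling where each position with $r+c\le n$ is either a crossing or a contact, and each position with $r+c=n+1$ is a single elbow, forming $n$ pipes; the pipe entering from the left edge at row $j$ is called pipe $j$, it travels only east and north and exits at the top edge. At a crossing, the pipe coming from the west continues east and the pipe coming from the south continues north. At a contact, one pipe comes from the west and turns north (the northwest pipe of the contact) and another comes from the south and turns east (the southeast pipe). Pipe dreams are required to be reduced: two pipes cross at most once. $\mathrm{PD}(\omega)$ is the set of pipe dreams in which pipe $j$ exits the top edge at column $\omega^{-1}(j)$ for every $j$. The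 contact graph $P^{\#}$ of $P$ is the directed multigraph on $[n]$ with one arc from the northwest pipe to the southeast pipe of each contact of $P$. $P$ is acyclic if $P^{\#}$ has no directed cycle; $\mathrm{APD}(\omega)$ denotes the set of acyclic pipe dreams in $\mathrm{PD}(\omega)$. A linear extension of $P$ is a permutation $\pi\in\mathfrak S_n$ with $\pi^{-1}(i)<\pi^{-1}(j)$ for every arc $i\to j$ of $P^{\#}$; $\mathcal L(P)$ denotes the set of linear extensions of $P$. *)

theory Defs
  imports "HOL-Combinatorics.Permutations" "HOL-Library.Disjoint_Sets" "Graph_Theory.Arc_Walk"
begin

section \<open>Weak order\<close>

definition inversions :: "nat \<Rightarrow> (nat \<Rightarrow> nat) \<Rightarrow> (nat \<times> nat) set" where
  "inversions n \<pi> = {(i, j). i \<in> {1..n} \<and> j \<in> {1..n} \<and> i < j \<and> inv \<pi> i > inv \<pi> j}"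

definition weak_le :: "nat \<Rightarrow> (nat \<Rightarrow> nat) \<Rightarrow> (nat \<Rightarrow> nat) \<Rightarrow> bool" where
  "weak_le n \<pi> \<sigma> \<longleftrightarrow> inversions n \<pi> \<subseteq> inversions n \<sigma>"

definition weak_lower_interval :: "nat \<Rightarrow> (nat \<Rightarrow> nat) \<Rightarrow> (nat \<Rightarrow> nat) set" where
  "weak_lower_interval n \<omega> = {\<pi>. \<pi> permutes {1..n} \<and> weak_le n \<pi> \<omega>}"


section \<open>Pipe dreams\<close>

text \<open>A position is a pair (row, column), both starting at 1 and with rows counted from the top.
  A filling is represented by its set \<open>C\<close> of crossings: the other inner positions are contacts,
  and the positions on the antidiagonal are single elbows.\<close>

definition inner_positions :: "nat \<Rightarrow> (nat \<times> nat) set" where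
  "inner_positions n = {(r, c). 1 \<le> r \<and> 1 \<le> c \<and> r + c \<le> n}"

definition elbows :: "nat \<Rightarrow> (nat \<times> nat) set" where
  "elbows n = {(r, c). 1 \<le> r \<and> 1 \<le> c \<and> r + c = n + 1}"

definition contacts :: "nat \<Rightarrow> (nat \<times> nat) set \<Rightarrow> (nat \<times> nat) set" where
  "contacts n C = inner_positions n - C"

datatype side = West | South

text \<open>\<open>enters n C j West r c\<close> and \<open>enters n C j South r c\<close> say that pipe \<open>j\<close> reaches position
  \<open>(r, c)\<close> through its west, respectively south, side. Row 0 lies above the top edge, so reaching
  \<open>(0, c)\<close> from the south means exiting the top edge at column \<open>c\<close>.\<close>

inductive enters :: "nat \<Rightarrow> (nat \<times> nat) set \<Rightarrow> nat \<Rightarrow> side \<Rightarrow> nat \<Rightarrow> nat \<Rightarrow> bool"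
  for n C j where
  start: "j \<in> {1..n} \<Longrightarrow> enters n C j West j 1"
| cross_east: "enters n C j West r c \<Longrightarrow> (r, c) \<in> C \<Longrightarrow> enters n C j West r (Suc c)"
| cross_north: "enters n C j South (Suc r) c \<Longrightarrow> (Suc r, c) \<in> C \<Longrightarrow> enters n C j South r c"
| turn_north: "enters n C j West (Suc r) c \<Longrightarrow> (Suc r, c) \<in> contacts n C \<union> elbows n
    \<Longrightarrow> enters n C j South r c"
| turn_east: "enters n C j South r c \<Longrightarrow> (r, c) \<in> contacts n C \<Longrightarrow> enters n C j West r (Suc c)"

definition exits_at :: "nat \<Rightarrow> (nat \<times> nat) set \<Rightarrow> nat \<Rightarrow> nat \<Rightarrow> bool" where
  "exits_at n C j c \<longleftrightarrow> enters n C j South 0 c"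

definition cross_at :: "nat \<Rightarrow> (nat \<times> nat) set \<Rightarrow> nat \<Rightarrow> nat \<Rightarrow> nat \<times> nat \<Rightarrow> bool" where
  "cross_at n C i j = (\<lambda>(r, c). (r, c) \<in> C \<and>
     (enters n C i West r c \<and> enters n C j South r c \<or>
      enters n C j West r c \<and> enters n C i South r c))"

definition reduced :: "nat \<Rightarrow> (nat \<times> nat) set \<Rightarrow> bool" where
  "reduced n C \<longleftrightarrow> (\<forall>i j p q. cross_at n C i j p \<and> cross_at n C i j q \<longrightarrow> p = q)"

definition PD :: "nat \<Rightarrow> (nat \<Rightarrow> nat) \<Rightarrow> (nat \<times> nat) set set" where
  "PD n \<omega> = {C. C \<subseteq> inner_positions n \<and> reduced n C \<and> (\<forall>j\<in>{1..n}. exits_at n C j (inv \<omega> j))}"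


section \<open>Contact graphs and linear extensions\<close>

text \<open>Each side of an inner position is reached by exactly one pipe, so the pipe below is
  well-defined there.\<close>

definition pipe_at :: "nat \<Rightarrow> (nat \<times> nat) set \<Rightarrow> side \<Rightarrow> nat \<times> nat \<Rightarrow> nat" where
  "pipe_at n C s = (\<lambda>(r, c). THE j. enters n C j s r c)"

text \<open>The pipe reaching a contact from the west turns north and is its northwest pipe; the one
  reaching it from the south turns east and is its southeast pipe.\<close>

definition contact_graph :: "nat \<Rightarrow> (nat \<times> nat) set \<Rightarrow> (nat, nat \<times> nat) pre_digraph" where
  "contact_graph n C =
     \<lparr>verts = {1..n}, arcs = contacts n C, tail = pipe_at n C West, head = pipe_at n C South\<rparr>"

definition APD :: "nat \<Rightarrow> (nat \<Rightarrow> nat) \<Rightarrow> (nat \<times> nat) set set" where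
  "APD n \<omega> = {C \<in> PD n \<omega>. \<not> (\<exists>p. pre_digraph.cycle (contact_graph n C) p)}"

definition linear_extensions :: "nat \<Rightarrow> (nat \<times> nat) set \<Rightarrow> (nat \<Rightarrow> nat) set" where
  "linear_extensions n C = {\<pi>. \<pi> permutes {1..n} \<and>
     (\<forall>(i, j)\<in>arcs_ends (contact_graph n C). inv \<pi> i < inv \<pi> j)}"

end

theory Submission
  imports Defs
begin

text \<open>Fix a linear order \<open>\<pi>\<close> and sweep the columns from left to right, each from bottom to top,
  so that the pipe carried upwards in column \<open>c\<close> meets the pipes coming from the west one after
  the other. If \<open>P\<close> is in \<open>PD(\<omega>)\<close> and \<open>\<pi>\<close> is a linear extension of \<open>P\<close>, then every position of
  \<open>P\<close> is forced: the carried pipe \<open>s\<close> crosses the western pipe \<open>w\<close> if and only if \<open>s = \<omega>(c)\<close>, in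
  which case it is about to leave the grid, or \<open>s\<close> precedes \<open>w\<close> in \<open>\<pi>\<close>. Conversely, this greedy
  rule yields an element of \<open>PD(\<omega>)\<close> with linear extension \<open>\<pi>\<close> as soon as \<open>\<pi> \<le> \<omega>\<close>. Both
  directions rest on the invariant that two pipes entering a column in the order in which they
  occur in \<open>\<omega>\<close> also occur in this order in \<open>\<pi>\<close>; for the first column it says \<open>\<pi> \<le> \<omega>\<close>.\<close>

section \<open>A single column\<close>

text \<open>Row \<open>r\<close> of a column of height \<open>m\<close> is reached by \<open>u r\<close> from the west and by \<open>v r\<close> from the
  south, and the crossings are the rows satisfying \<open>X\<close>. The next column receives \<open>u' r\<close> in row \<open>r\<close>;
  the pipe leaving at the top counts as \<open>u' 0\<close>, so that \<open>u'\<close> carries the same pipes as \<open>u\<close>.\<close>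

locale column =
  fixes m :: nat and u v u' :: "nat \<Rightarrow> 'a" and X :: "nat \<Rightarrow> bool"
  assumes inj: "inj_on u {1..m}"
    and m_pos: "0 < m"
    and v_last: "v (m - 1) = u m"
    and v_step: "\<And>r. Suc r < m \<Longrightarrow> v r = (if X (Suc r) then v (Suc r) else u (Suc r))"
    and u'_0: "u' 0 = v 0"
    and u'_step: "\<And>r. 0 < r \<Longrightarrow> r < m \<Longrightarrow> u' r = (if X r then u r else v r)"
begin

lemma u_inj: "u i = u j \<Longrightarrow> 1 \<le> i \<Longrightarrow> i \<le> m \<Longrightarrow> 1 \<le> j \<Longrightarrow> j \<le> m \<Longrightarrow> i = j"
  by (rule inj_onD[OF inj]) auto

text \<open>Conservation of pipes: row \<open>Suc k\<close> takes in \<open>u (Suc k)\<close> and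
  \<open>v (Suc k)\<close> and hands out the same two pipes as \<open>v k\<close> and
  \<open>u' (Suc k)\<close>, in one order or the other. The rows are added one by one, starting from
  the bottom.\<close>

lemma insert_v_image:
  assumes "k < m"
  shows "insert (v k) (u' ` {k<..<m}) = u ` {k<..m}"
proof -
  have "k \<le> m - 1" using assms by simp
  then show ?thesis
  proof (induction k rule: inc_induct)
    case base
    have "{m - 1<..<m} = {}" "{m - 1<..m} = {m}" using m_pos by auto
    then show ?case using v_last by simp
  next
    case (step k)
    have "{k<..<m} = insert (Suc k) {Suc k<..<m}" "{k<..m} = insert (Suc k) {Suc k<..m}"
      using step.hyps by auto
    then show ?case
      using step.hyps step.IH v_step[of k] u'_step[of "Suc k"] by (cases "X (Suc k)") auto
  qed
qed

text \<open>Counting: by \<open>insert_v_image\<close> the \<open>m - k\<close> outgoing slots hold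
  \<open>m - k\<close> different pipes, so no two slots hold the same one.\<close>

lemma v_notin:
  assumes "k < m"
  shows "inj_on u' {k<..<m}" "v k \<notin> u' ` {k<..<m}"
proof -
  have "card (u ` {k<..m}) = m - k"
  proof -
    have "{k<..m} \<subseteq> {1..m}" by auto
    then have "inj_on u {k<..m}" by (rule inj_on_subset[OF inj])
    then show ?thesis by (simp add: card_image)
  qed
  then have c: "card (insert (v k) (u' ` {k<..<m})) = m - k"
    using insert_v_image[OF assms] by simp
  have le: "card (u' ` {k<..<m}) \<le> m - Suc k"
    using card_image_le[of "{k<..<m}" u'] by simp
  show nin: "v k \<notin> u' ` {k<..<m}"
    using c le assms by (auto simp: insert_absorb)
  then have "card (u' ` {k<..<m}) = card {k<..<m}" using c assms by simp
  then show "inj_on u' {k<..<m}" by (simp add: eq_card_imp_inj_on)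
qed

lemma u'_image: "u' ` {..<m} = u ` {1..m}"
proof -
  have "{..<m} = insert 0 {0<..<m}" using m_pos by auto
  moreover have "{0<..m} = {1..m}" by auto
  ultimately show ?thesis using insert_v_image[OF m_pos] u'_0 by simp
qed

lemma u'_inj: "inj_on u' {..<m}"
proof -
  have "{..<m} = insert 0 {0<..<m}" using m_pos by auto
  then show ?thesis using v_notin[OF m_pos] u'_0 by simp
qed

lemma v_from:
  assumes "k < m"
  shows "\<exists>i. k < i \<and> i \<le> m \<and> v k = u i"
proof -
  have "v k \<in> u ` {k<..m}" unfolding insert_v_image[OF assms, symmetric] by simp
  then show ?thesis by auto
qed

lemma u'_from:
  assumes "0 < r" "r < m"
  shows "\<exists>i. r \<le> i \<and> i \<le> m \<and> u' r = u i"
proof (cases "X r")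
  case True
  then show ?thesis using u'_step[OF assms] assms by (intro exI[of _ r]) simp
next
  case False
  obtain i where "r < i" "i \<le> m" "v r = u i" using v_from assms by blast
  then show ?thesis using u'_step[OF assms] False by (intro exI[of _ i]) simp
qed

lemma u'_from_le:
  assumes "0 < r" "r < m" "u' r = u j" "1 \<le> j" "j \<le> m"
  shows "r \<le> j"
proof -
  obtain i where i: "r \<le> i" "i \<le> m" "u' r = u i" using u'_from assms by blast
  have "i = j"
  proof (rule u_inj)
    show "u i = u j" using i(3) assms(3) by (rule subst)
  qed (use i assms(1,4,5) in auto)
  then show ?thesis using i(1) by simp
qed

text \<open>Above row \<open>r\<close>, a contact replaces the carried pipe by one that entered
  above row \<open>r\<close>, hence above the pipe \<open>u' r\<close>, while a crossing keeps the
  carried pipe. This reduces the claim to row \<open>r\<close> itself, where only a crossing can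
  reverse the order.\<close>

lemma v_order:
  assumes "k < r" "r < m" "v k = u i" "u' r = u j" "1 \<le> i" "i \<le> m" "1 \<le> j" "j \<le> m"
  shows "i < j \<or> X r \<and> u r = u' r \<and> v r = v k"
proof -
  have rj: "r \<le> j"
    using u'_from_le[of r j] assms by simp
  have "k \<le> r - 1" using assms by simp
  then show ?thesis using \<open>v k = u i\<close>
  proof (induction k rule: inc_induct)
    case base
    obtain h where h: "r < h" "h \<le> m" "v r = u h" using v_from[OF \<open>r < m\<close>] by blast
    show ?case
    proof (cases "X r")
      case True
      then show ?thesis using assms base v_step[of "r - 1"] u'_step[of r] by auto
    next
      case False
      then have "u' r = u h" "u i = u r"
        using assms base h v_step[of "r - 1"] u'_step[of r] by auto
      then have "u j = u h" using assms(4) by metis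
      then have "j = h" by (rule u_inj) (use assms(1,2,7,8) h in auto)
      moreover have "i = r" by (rule u_inj[OF \<open>u i = u r\<close>]) (use assms(1,2,5,6) in auto)
      ultimately show ?thesis using h(1) by simp
    qed
  next
    case (step k)
    show ?case
    proof (cases "X (Suc k)")
      case True
      then have "v k = v (Suc k)" using v_step[of k] step.hyps \<open>r < m\<close> by simp
      then show ?thesis using step.IH step.prems by simp
    next
      case False
      then have "u i = u (Suc k)" using v_step[of k] step.hyps step.prems \<open>r < m\<close> by simp
      then have "i = Suc k" by (rule u_inj) (use step.hyps assms(2,5,6) in auto)
      then have "i < j" using step.hyps rj by linarith
      then show ?thesis ..
    qed
  qed
qed

lemma u'_order:
  assumes "r < r'" "r' < m" "u' r = u i" "u' r' = u j" "1 \<le> i" "i \<le> m" "1 \<le> j" "j \<le> m"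
  shows "i < j \<or> X r' \<and> u r' = u' r' \<and> v r' = u' r"
\<comment> \<open>In row 0 or after a contact the outgoing pipe is the carried one, so
  \<open>v_order\<close> applies. After a crossing it has stayed in row \<open>r\<close>, whereas
  the pipe of row \<open>r'\<close> entered in row \<open>r'\<close> or below.\<close>
proof (cases "r = 0 \<or> \<not> X r")
  case True
  then have "u' r = v r" using u'_0 u'_step[of r] assms by (cases "r = 0") auto
  then show ?thesis using v_order[of r r' i j] assms by auto
next
  case False
  then have "u' r = u r" using u'_step[of r] assms by auto
  then have "u i = u r" using assms(3) by metis
  then have "i = r" by (rule u_inj) (use assms(1,2,5,6) False in auto)
  moreover have "r' \<le> j" using u'_from_le[of r' j] assms by simp
  ultimately show ?thesis using assms by simp
qed

text \<open>The southern pipe must leave the column somewhere, since \<open>u'\<close> carries the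
  same pipes as \<open>u\<close>. It cannot leave below row \<open>r'\<close> by
  \<open>v_notin\<close>, nor in row \<open>r'\<close>, which the western pipe keeps.\<close>

lemma crossing_swaps:
  assumes "0 < r'" "r' < m" "X r'"
  shows "\<exists>r<r'. u' r = v r'" "u' r' = u r'"
proof -
  have i: "\<exists>i. r' < i \<and> i \<le> m \<and> v r' = u i" using v_from assms by blast
  then have "v r' \<in> u ` {1..m}" using assms by auto
  then obtain r where r: "r < m" "u' r = v r'" using u'_image by force
  show eq: "u' r' = u r'" using u'_step assms by simp
  have "r \<noteq> r'"
  proof
    assume "r = r'"
    then obtain j where "r' < j" "j \<le> m" "u r' = u j" using i r eq by auto
    then have "r' = j" by (intro u_inj) (use assms in auto)
    then show False using \<open>r' < j\<close> by simp
  qed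
  moreover have "\<not> r' < r" using r v_notin(2)[of r'] assms by force
  ultimately show "\<exists>r<r'. u' r = v r'" using r by force
qed

end

section \<open>Pipes traced by a local rule\<close>

text \<open>\<open>X r c w s\<close> decides whether pipes \<open>w\<close> and \<open>s\<close>, coming from the west and from the south, cross
  at \<open>(r, c)\<close>. Row 0 of column \<open>c + 1\<close> holds the pipe that exits at column \<open>c\<close>.\<close>

function pipe ::
  "nat \<Rightarrow> (nat \<Rightarrow> nat \<Rightarrow> nat \<Rightarrow> nat \<Rightarrow> bool) \<Rightarrow> side \<Rightarrow> nat \<Rightarrow> nat \<Rightarrow> nat" where
  "pipe n X West r c =
     (if c \<le> 1 then r
      else if r = 0 then pipe n X South r (c - 1)
      else if X r (c - 1) (pipe n X West r (c - 1)) (pipe n X South r (c - 1))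
      then pipe n X West r (c - 1) else pipe n X South r (c - 1))"
| "pipe n X South r c =
     (if n \<le> r + c then pipe n X West (Suc r) c
      else if X (Suc r) c (pipe n X West (Suc r) c) (pipe n X South (Suc r) c)
      then pipe n X South (Suc r) c else pipe n X West (Suc r) c)"
  by pat_completeness auto
termination
  \<comment> \<open>Order of tracing: columns from left to right; within a column, western entries
    before carried pipes, and these from the bottom upwards.\<close>
  by (relation "measures
        [\<lambda>(n, X, s, r, c). c, \<lambda>(n, X, s, r, c). case s of West \<Rightarrow> 0 | South \<Rightarrow> 1,
         \<lambda>(n, X, s, r, c). n - r]") auto

declare pipe.simps [simp del]

locale pipe_rule =
  fixes n :: nat and X :: "nat \<Rightarrow> nat \<Rightarrow> nat \<Rightarrow> nat \<Rightarrow> bool"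
begin

abbreviation "W \<equiv> pipe n X West"
abbreviation "S \<equiv> pipe n X South"

definition crossing :: "nat \<Rightarrow> nat \<Rightarrow> bool" where
  "crossing r c \<longleftrightarrow> 1 \<le> r \<and> 1 \<le> c \<and> r + c \<le> n \<and> X r c (W r c) (S r c)"

definition contact :: "nat \<Rightarrow> nat \<Rightarrow> bool" where
  "contact r c \<longleftrightarrow> 1 \<le> r \<and> 1 \<le> c \<and> r + c \<le> n \<and> \<not> X r c (W r c) (S r c)"

lemma W_first: "W r (Suc 0) = r"
  by (simp add: pipe.simps)

lemma W_Suc:
  "1 \<le> c \<Longrightarrow> W r (Suc c) = (if 0 < r \<and> X r c (W r c) (S r c) then W r c else S r c)"
  by (subst pipe.simps) auto

lemma W_top: "1 \<le> c \<Longrightarrow> W 0 (Suc c) = S 0 c"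
  by (simp add: W_Suc)

lemma S_unfold:
  "S r c = (if r + c < n \<and> X (Suc r) c (W (Suc r) c) (S (Suc r) c) then S (Suc r) c
    else W (Suc r) c)"
  by (subst pipe.simps) auto

text \<open>Injectivity is a hypothesis of \<open>column\<close> and, for the next column, a
  consequence of it. Hence this conditional form, which feeds the induction in
  \<open>W_inj\<close>.\<close>

lemma column_if_inj:
  assumes "1 \<le> c" "c \<le> n" "inj_on (\<lambda>r. W r c) {1..n + 1 - c}"
  shows "column (n + 1 - c) (\<lambda>r. W r c) (\<lambda>r. S r c) (\<lambda>r. W r (Suc c)) (\<lambda>r. crossing r c)"
proof
  show "inj_on (\<lambda>r. W r c) {1..n + 1 - c}" by (rule assms)
  show "0 < n + 1 - c" using assms by simp
  show "S (n + 1 - c - 1) c = W (n + 1 - c) c"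
    using assms by (subst S_unfold) (auto simp: Suc_diff_le)
  show "S r c = (if crossing (Suc r) c then S (Suc r) c else W (Suc r) c)"
    if "Suc r < n + 1 - c" for r
    using assms that by (subst S_unfold) (auto simp: crossing_def)
  show "W 0 (Suc c) = S 0 c" using assms by (simp add: W_top)
  show "W r (Suc c) = (if crossing r c then W r c else S r c)"
    if "0 < r" "r < n + 1 - c" for r
    using assms that by (subst W_Suc) (auto simp: crossing_def)
qed

lemma W_inj:
  assumes "1 \<le> c" "c \<le> n"
  shows "inj_on (\<lambda>r. W r c) {1..n + 1 - c}"
  using assms
proof (induction c rule: dec_induct)
  case base
  then show ?case by (simp add: W_first inj_on_def)
next
  case (step c)
  then interpret column "n + 1 - c" "\<lambda>r. W r c" "\<lambda>r. S r c" "\<lambda>r. W r (Suc c)"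
      "\<lambda>r. crossing r c"
    by (intro column_if_inj) auto
  have "{1..n + 1 - Suc c} \<subseteq> {..<n + 1 - c}" by auto
  then show ?case using u'_inj inj_on_subset by blast
qed

lemma column_at:
  assumes "1 \<le> c" "c \<le> n"
  shows "column (n + 1 - c) (\<lambda>r. W r c) (\<lambda>r. S r c) (\<lambda>r. W r (Suc c)) (\<lambda>r. crossing r c)"
  using column_if_inj W_inj assms by blast

lemma W_eq_iff:
  "1 \<le> c \<Longrightarrow> 1 \<le> r \<Longrightarrow> r + c \<le> n + 1 \<Longrightarrow> 1 \<le> r' \<Longrightarrow> r' + c \<le> n + 1 \<Longrightarrow>
    W r c = W r' c \<longleftrightarrow> r = r'"
  by (rule inj_on_eq_iff[OF W_inj[of c]]) auto

lemma W_Suc_eq_iff: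
  assumes "1 \<le> c" "r + c \<le> n" "r' + c \<le> n"
  shows "W r (Suc c) = W r' (Suc c) \<longleftrightarrow> r = r'"
proof -
  interpret column "n + 1 - c" "\<lambda>r. W r c" "\<lambda>r. S r c" "\<lambda>r. W r (Suc c)" "\<lambda>r. crossing r c"
    by (rule column_at) (use assms in auto)
  show ?thesis by (rule inj_on_eq_iff[OF u'_inj]) (use assms in auto)
qed

lemma W_Suc_from:
  assumes "1 \<le> c" "r + c \<le> n"
  shows "\<exists>i. 1 \<le> i \<and> i + c \<le> n + 1 \<and> W r (Suc c) = W i c"
proof -
  interpret column "n + 1 - c" "\<lambda>r. W r c" "\<lambda>r. S r c" "\<lambda>r. W r (Suc c)" "\<lambda>r. crossing r c"
    by (rule column_at) (use assms in auto)
  have "W r (Suc c) \<in> (\<lambda>r. W r (Suc c)) ` {..<n + 1 - c}" using assms by auto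
  then obtain i where i: "i \<in> {1..n + 1 - c}" "W r (Suc c) = W i c" unfolding u'_image by blast
  have "1 \<le> i" "i + c \<le> n + 1" using i(1) assms by auto
  then show ?thesis using i(2) by blast
qed

lemma S_from:
  assumes "1 \<le> c" "r + c \<le> n"
  shows "\<exists>i. r < i \<and> i + c \<le> n + 1 \<and> S r c = W i c"
proof -
  interpret column "n + 1 - c" "\<lambda>r. W r c" "\<lambda>r. S r c" "\<lambda>r. W r (Suc c)" "\<lambda>r. crossing r c"
    by (rule column_at) (use assms in auto)
  obtain i where i: "r < i" "i \<le> n + 1 - c" "S r c = W i c" using v_from[of r] assms by (auto simp: less_diff_conv)
  have "i + c \<le> n + 1" using i(2) assms by auto
  then show ?thesis using i by blast
qed

lemma W_neq_S:
  assumes "1 \<le> c" "1 \<le> r" "r + c \<le> n"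
  shows "W r c \<noteq> S r c"
  using S_from[of c r] assms W_eq_iff by force

lemma W_to:
  assumes "1 \<le> c" "1 \<le> i" "i + c \<le> n + 1"
  shows "\<exists>r. r + c \<le> n \<and> W i c = W r (Suc c)"
proof -
  interpret column "n + 1 - c" "\<lambda>r. W r c" "\<lambda>r. S r c" "\<lambda>r. W r (Suc c)" "\<lambda>r. crossing r c"
    by (rule column_at) (use assms in auto)
  have "W i c \<in> (\<lambda>r. W r c) ` {1..n + 1 - c}" using assms by auto
  then obtain r where r: "r \<in> {..<n + 1 - c}" "W i c = W r (Suc c)" unfolding u'_image[symmetric] by blast
  have "r + c \<le> n" using r(1) assms by auto
  then show ?thesis using r(2) by blast
qed

lemma order_step:
  assumes "1 \<le> c" "r < r'" "r' + c \<le> n" "W r (Suc c) = W i c" "W r' (Suc c) = W j c"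
    "1 \<le> i" "i + c \<le> n + 1" "1 \<le> j" "j + c \<le> n + 1"
  shows "i < j \<or> crossing r' c \<and> W r' c = W r' (Suc c) \<and> S r' c = W r (Suc c)"
proof -
  interpret column "n + 1 - c" "\<lambda>r. W r c" "\<lambda>r. S r c" "\<lambda>r. W r (Suc c)" "\<lambda>r. crossing r c"
    by (rule column_at) (use assms in auto)
  show ?thesis by (rule u'_order) (use assms in auto)
qed

lemma crossing_swaps:
  assumes "crossing r' c"
  shows "\<exists>r<r'. W r (Suc c) = S r' c" "W r' (Suc c) = W r' c"
proof -
  have b: "1 \<le> r'" "1 \<le> c" "r' + c \<le> n" using assms by (auto simp: crossing_def)
  interpret column "n + 1 - c" "\<lambda>r. W r c" "\<lambda>r. S r c" "\<lambda>r. W r (Suc c)" "\<lambda>r. crossing r c"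
    by (rule column_at) (use b in auto)
  show "\<exists>r<r'. W r (Suc c) = S r' c" "W r' (Suc c) = W r' c"
    using crossing_swaps[of r'] assms b by auto
qed

lemma labels_step:
  assumes "1 \<le> c" "c \<le> n"
  shows "(\<lambda>r. W r c) ` {1..n + 1 - c} = insert (S 0 c) ((\<lambda>r. W r (Suc c)) ` {1..n - c})"
    and "S 0 c \<notin> (\<lambda>r. W r (Suc c)) ` {1..n - c}"
proof -
  interpret column "n + 1 - c" "\<lambda>r. W r c" "\<lambda>r. S r c" "\<lambda>r. W r (Suc c)" "\<lambda>r. crossing r c"
    by (rule column_at) (use assms in auto)
  have e: "{0<..<n + 1 - c} = {1..n - c}" "{0<..n + 1 - c} = {1..n + 1 - c}" using assms by auto
  show "(\<lambda>r. W r c) ` {1..n + 1 - c} = insert (S 0 c) ((\<lambda>r. W r (Suc c)) ` {1..n - c})"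
    "S 0 c \<notin> (\<lambda>r. W r (Suc c)) ` {1..n - c}"
    using insert_v_image[OF m_pos] v_notin(2)[OF m_pos] unfolding e by auto
qed

lemma order_persists:
  assumes "1 \<le> c" "c \<le> d"
    and base: "\<And>s s'. s + c \<le> n \<Longrightarrow> s' + c \<le> n \<Longrightarrow> W s (Suc c) = x \<Longrightarrow> W s' (Suc c) = y \<Longrightarrow> s < s'"
    and no_cross: "\<And>r d. c < d \<Longrightarrow> crossing r d \<Longrightarrow> W r d = x \<Longrightarrow> S r d = y \<Longrightarrow> False"
    and "s + d \<le> n" "s' + d \<le> n" "W s (Suc d) = x" "W s' (Suc d) = y" "x \<noteq> y"
  shows "s < s'"
  using \<open>c \<le> d\<close> \<open>s + d \<le> n\<close> \<open>s' + d \<le> n\<close> \<open>W s (Suc d) = x\<close> \<open>W s' (Suc d) = y\<close>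
proof (induction d arbitrary: s s' rule: dec_induct)
  case base
  then show ?case using assms(3) by blast
next
  case (step d)
  have d: "1 \<le> Suc d" using assms by simp
  obtain i where i: "1 \<le> i" "i + Suc d \<le> n + 1" "x = W i (Suc d)"
    using W_Suc_from[OF d step.prems(1)] step.prems by auto
  obtain j where j: "1 \<le> j" "j + Suc d \<le> n + 1" "y = W j (Suc d)"
    using W_Suc_from[OF d step.prems(2)] step.prems by auto
  have ij: "i < j" using step.IH[of i j] i j by auto
  show ?case
  proof (rule ccontr)
    assume "\<not> s < s'"
    then have "s' < s" using step.prems \<open>x \<noteq> y\<close> by (metis linorder_neqE_nat)
    then have "crossing s (Suc d) \<and> W s (Suc d) = x \<and> S s (Suc d) = y"
      using order_step[OF d, of s' s j i] i j ij step.prems by auto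
    then show False using no_cross[of "Suc d" s] step.hyps by auto
  qed
qed

end

section \<open>Reducedness and linear extensions, column by column\<close>

text \<open>\<open>q x\<close> is the column at which pipe \<open>x\<close> is meant to exit;
  whether it does so is the separate property \<open>exits\<close>.\<close>

locale target_rule = pipe_rule +
  fixes \<omega> q :: "nat \<Rightarrow> nat"
  assumes q_\<omega>: "\<And>c. q (\<omega> c) = c"
    and labels: "\<omega> ` {1..n} = {1..n}"
begin

definition exits :: bool where
  "exits \<longleftrightarrow> (\<forall>c. 1 \<le> c \<and> c \<le> n \<longrightarrow> S 0 c = \<omega> c)"

text \<open>A local substitute for reducedness: given \<open>exits\<close>, it is equivalent to
  \<open>single_crossings\<close>.\<close>

definition ordered_crossings :: bool where
  "ordered_crossings \<longleftrightarrow> (\<forall>r c. crossing r c \<longrightarrow> q (S r c) < q (W r c))"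

definition single_crossings :: bool where
  "single_crossings \<longleftrightarrow> (\<forall>r c r' c'. crossing r c \<and> crossing r' c' \<and>
     {W r c, S r c} = {W r' c', S r' c'} \<longrightarrow> (r, c) = (r', c'))"

lemma \<omega>_eq_iff: "\<omega> a = \<omega> b \<longleftrightarrow> a = b"
  by (metis q_\<omega>)

text \<open>Each column sheds the pipe leaving at its top. Only exits to the left of
  \<open>c\<close> are assumed, so that the lemma is available while exits are still being
  established from left to right.\<close>

lemma column_labels:
  assumes "1 \<le> c" "c \<le> Suc n" "\<And>d. 1 \<le> d \<Longrightarrow> d < c \<Longrightarrow> S 0 d = \<omega> d"
  shows "(\<lambda>r. W r c) ` {1..n + 1 - c} = \<omega> ` {c..n}"
  using assms
proof (induction c rule: dec_induct)
  case base
  then show ?case using labels by (simp add: W_first)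
next
  case (step c)
  have c: "1 \<le> c" "c \<le> n" using step by auto
  have "(\<lambda>r. W r c) ` {1..n + 1 - c} = \<omega> ` {c..n}" using step by auto
  moreover have "{c..n} = insert c {Suc c..n}" using c by auto
  ultimately have "insert (\<omega> c) ((\<lambda>r. W r (Suc c)) ` {1..n - c}) = insert (\<omega> c) (\<omega> ` {Suc c..n})"
    using labels_step(1)[OF c] step.prems(2)[of c] c by simp
  moreover have "\<omega> c \<notin> (\<lambda>r. W r (Suc c)) ` {1..n - c}"
    using labels_step(2)[OF c] step.prems(2)[of c] c by simp
  moreover have "\<omega> c \<notin> \<omega> ` {Suc c..n}" by (auto simp: \<omega>_eq_iff)
  ultimately have "(\<lambda>r. W r (Suc c)) ` {1..n - c} = \<omega> ` {Suc c..n}" by (metis insert_ident)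
  then show ?case by simp
qed

lemma W_label:
  assumes "1 \<le> c" "\<And>d. 1 \<le> d \<Longrightarrow> d < c \<Longrightarrow> S 0 d = \<omega> d" "1 \<le> r" "r + c \<le> n + 1"
  shows "c \<le> q (W r c)" "q (W r c) \<le> n" "\<omega> (q (W r c)) = W r c"
proof -
  have "W r c \<in> \<omega> ` {c..n}" using column_labels[of c] assms by auto
  then show "c \<le> q (W r c)" "q (W r c) \<le> n" "\<omega> (q (W r c)) = W r c" by (auto simp: q_\<omega>)
qed

lemma W_at:
  assumes "1 \<le> c" "\<And>d. 1 \<le> d \<Longrightarrow> d < c \<Longrightarrow> S 0 d = \<omega> d" "c \<le> a" "a \<le> n"
  obtains r where "1 \<le> r" "r + c \<le> n + 1" "W r c = \<omega> a"
proof -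
  have "\<omega> a \<in> (\<lambda>r. W r c) ` {1..n + 1 - c}" using column_labels[of c] assms by auto
  then obtain r where "r \<in> {1..n + 1 - c}" "\<omega> a = W r c" by blast
  then show ?thesis using that[of r] assms by auto
qed

text \<open>Two crossings of the same pipes would have the same western and the same southern pipe.
  The first one puts the southern pipe above the western one; to be below again at the second, it
  would need a crossing with exchanged roles in between.\<close>

lemma ordered_crossings_imp_single_crossings:
  assumes "ordered_crossings"
  shows "single_crossings"
proof -
  have ord: "crossing r c \<Longrightarrow> q (S r c) < q (W r c)" for r c
    using assms by (simp add: ordered_crossings_def)
  have main: "(r, c) = (r', c')"
    if cr: "crossing r c" "crossing r' c'" and eq: "{W r c, S r c} = {W r' c', S r' c'}"
      and le: "c \<le> c'" for r c r' c'
  proof -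
    have b: "1 \<le> r" "1 \<le> c" "r + c \<le> n" "1 \<le> r'" "1 \<le> c'" "r' + c' \<le> n"
      using cr by (auto simp: crossing_def)
    have WS: "W r' c' = W r c" "S r' c' = S r c"
      using eq ord[OF cr(1)] ord[OF cr(2)] by (auto simp: doubleton_eq_iff)
    show ?thesis
    proof (cases "c = c'")
      case True
      then show ?thesis using WS W_eq_iff[of c r r'] b by auto
    next
      case False
      then have lt: "c < c'" using le by simp
      obtain k where k: "k < r" "W k (Suc c) = S r c" using crossing_swaps(1)[OF cr(1)] by blast
      have y: "W r (Suc c) = W r c" using crossing_swaps(2)[OF cr(1)] .
      obtain i where i: "r' < i" "i + c' \<le> n + 1" "S r' c' = W i c'" using S_from b by blast
      \<comment> \<open>\<open>order_persists\<close> speaks of rows on leaving a column, so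
        entering column \<open>c'\<close> is expressed as leaving column
        \<open>c' - 1\<close>.\<close>
      have c': "Suc (c' - 1) = c'" using b by simp
      have "i < r'"
      proof (rule order_persists[of c "c' - 1" "S r c" "W r c"])
        show "1 \<le> c" "c \<le> c' - 1" using b lt by auto
        show "i + (c' - 1) \<le> n" "r' + (c' - 1) \<le> n" using i b by auto
        show "W i (Suc (c' - 1)) = S r c" "W r' (Suc (c' - 1)) = W r c" unfolding c' using i WS by auto
        show "S r c \<noteq> W r c" using W_neq_S[of c r] b by auto
        show "s < s'" if "s + c \<le> n" "s' + c \<le> n" "W s (Suc c) = S r c" "W s' (Suc c) = W r c" for s s'
        proof -
          have "s = k" using W_Suc_eq_iff[of c s k] that k b by auto
          moreover have "s' = r" using W_Suc_eq_iff[of c s' r] that y b by auto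
          ultimately show ?thesis using k by simp
        qed
        show False if "crossing t d" "W t d = S r c" "S t d = W r c" for t d
          using ord[OF that(1)] ord[OF cr(1)] that by simp
      qed
      then show ?thesis using i by simp
    qed
  qed
  show ?thesis
    unfolding single_crossings_def
  proof (intro allI impI, elim conjE)
    fix r c r' c'
    assume "crossing r c" "crossing r' c'" "{W r c, S r c} = {W r' c', S r' c'}"
    then show "(r, c) = (r', c')"
      using main[of r c r' c'] main[of r' c' r c] by (cases "c \<le> c'") auto
  qed
qed

text \<open>Suppose the western pipe had the earlier exit \<open>b'\<close>. The southern pipe is
  above it after the crossing and never crosses it again, so it would have to be above row 0 when
  the western pipe exits.\<close>

lemma single_crossings_imp_ordered_crossings:
  assumes single: "single_crossings" and ex: "exits"
  shows "ordered_crossings"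
  unfolding ordered_crossings_def
proof (intro allI impI)
  fix r c
  assume cr: "crossing r c"
  have S0: "S 0 d = \<omega> d" if "1 \<le> d" "d \<le> n" for d using ex that by (simp add: exits_def)
  have b: "1 \<le> r" "1 \<le> c" "r + c \<le> n" using cr by (auto simp: crossing_def)
  obtain i where i: "r < i" "i + c \<le> n + 1" "S r c = W i c" using S_from b by blast
  obtain k where k: "k < r" "W k (Suc c) = S r c" using crossing_swaps(1)[OF cr] by blast
  have y: "W r (Suc c) = W r c" using crossing_swaps(2)[OF cr] .
  define a b' where "a = q (S r c)" and "b' = q (W r c)"
  have a: "c \<le> a" "a \<le> n" "\<omega> a = S r c"
    using W_label[of c i] S0 i b by (auto simp: a_def)
  have b': "c \<le> b'" "b' \<le> n" "\<omega> b' = W r c"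
    using W_label[of c r] S0 b by (auto simp: b'_def)
  have ne: "S r c \<noteq> W r c" using W_neq_S[of c r] b by auto
  have "\<not> b' < a"
  proof
    assume lt: "b' < a"
    obtain s where s: "1 \<le> s" "s + Suc b' \<le> n + 1" "W s (Suc b') = \<omega> a"
      by (rule W_at[of "Suc b'" a]) (use S0 lt a b b' in auto)
    have "s < 0"
    proof (rule order_persists[of c b' "S r c" "W r c"])
      show "1 \<le> c" "c \<le> b'" using b b' by auto
      show "s + b' \<le> n" "0 + b' \<le> n" using s b' by auto
      show "W s (Suc b') = S r c" using s a by simp
      show "W 0 (Suc b') = W r c" using W_top[of b'] S0[of b'] b b' by simp
      show "S r c \<noteq> W r c" by (rule ne)
      show "s < s'" if "s + c \<le> n" "s' + c \<le> n" "W s (Suc c) = S r c" "W s' (Suc c) = W r c" for s s'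
      proof -
        have "s = k" using W_Suc_eq_iff[of c s k] that k b by auto
        moreover have "s' = r" using W_Suc_eq_iff[of c s' r] that y b by auto
        ultimately show ?thesis using k by simp
      qed
      show False if d: "c < d" and "crossing t d" "W t d = S r c" "S t d = W r c" for t d
      proof -
        have "{W r c, S r c} = {W t d, S t d}" using that by auto
        then have "(r, c) = (t, d)"
          using single cr that(2) unfolding single_crossings_def by blast
        then show ?thesis using d by simp
      qed
    qed
    then show False by simp
  qed
  moreover have "a \<noteq> b'" using a b' ne by auto
  ultimately show "q (S r c) < q (W r c)" by (simp add: a_def b'_def)
qed

end

section \<open>Linear extensions and the greedy rule\<close>

locale extension_rule = target_rule +
  fixes p :: "nat \<Rightarrow> nat"
  assumes inj_p: "\<And>x y. p x = p y \<Longrightarrow> x = y"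
begin

text \<open>In the application \<open>p\<close> is \<open>inv \<pi>\<close>, and each contact
  contributes the arc from \<open>W r c\<close> to \<open>S r c\<close>.\<close>

definition extends :: bool where
  "extends \<longleftrightarrow> (\<forall>r c. contact r c \<longrightarrow> p (W r c) < p (S r c))"

definition greedy :: bool where
  "greedy \<longleftrightarrow> (\<forall>r c. 1 \<le> r \<and> 1 \<le> c \<and> r + c \<le> n \<longrightarrow>
     (crossing r c \<longleftrightarrow> S r c = \<omega> c \<or> p (S r c) < p (W r c)))"

definition column_compatible :: "nat \<Rightarrow> bool" where
  "column_compatible c \<longleftrightarrow> (\<forall>i j. 1 \<le> i \<and> i < j \<and> j + c \<le> n + 1 \<and> q (W i c) < q (W j c) \<longrightarrow>
     p (W i c) < p (W j c))"

lemma column_compatibleD: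
  "column_compatible c \<Longrightarrow> 1 \<le> i \<Longrightarrow> i < j \<Longrightarrow> j + c \<le> n + 1 \<Longrightarrow> q (W i c) < q (W j c) \<Longrightarrow>
    p (W i c) < p (W j c)"
  unfolding column_compatible_def by blast

lemma S_step:
  "Suc r + c \<le> n \<Longrightarrow> 1 \<le> c \<Longrightarrow> S r c = (if crossing (Suc r) c then S (Suc r) c else W (Suc r) c)"
  by (subst S_unfold) (auto simp: crossing_def)

lemma S_last: "n \<le> r + c \<Longrightarrow> S r c = W (Suc r) c"
  by (subst S_unfold) auto

lemma p_S_mono:
  assumes lin: "extends" and "1 \<le> c" "k \<le> l" "l + c \<le> n"
  shows "p (S k c) \<le> p (S l c)"
  using \<open>k \<le> l\<close>
proof (induction k rule: inc_induct)
  case base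
  then show ?case by simp
next
  case (step k)
  have "p (S k c) \<le> p (S (Suc k) c)"
  proof (cases "crossing (Suc k) c")
    case True
    then show ?thesis using S_step[of k c] step assms by simp
  next
    case False
    then have "contact (Suc k) c" using step assms by (auto simp: contact_def crossing_def)
    then have "p (W (Suc k) c) < p (S (Suc k) c)" using lin by (simp add: extends_def)
    then show ?thesis using S_step[of k c] False step assms by simp
  qed
  then show ?case using step by simp
qed

text \<open>Each contact replaces the carried pipe by one that is earlier in \<open>p\<close>, so the pipe leaving at the
  top of the column precedes all pipes carried before it. The other pairs are compared in the next
  column.\<close>

lemma extends_imp_column_compatible:
  assumes ex: "exits" and ord: "ordered_crossings" and lin: "extends" and "1 \<le> c" "c \<le> Suc n"
  shows "column_compatible c"
  using \<open>c \<le> Suc n\<close> \<open>1 \<le> c\<close>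
proof (induction c rule: inc_induct)
  \<comment> \<open>The induction runs from right to left and starts past the last column, where
    there are no pairs.\<close>
  case base
  then show ?case by (auto simp: column_compatible_def)
next
  case (step c)
  have c: "1 \<le> c" "c \<le> n" using step by auto
  have S0: "S 0 d = \<omega> d" if "1 \<le> d" "d \<le> n" for d using ex that by (simp add: exits_def)
  have IH: "p (W s (Suc c)) < p (W s' (Suc c))"
    if "1 \<le> s" "s < s'" "s' + c \<le> n" "q (W s (Suc c)) < q (W s' (Suc c))" for s s'
    using step.IH that unfolding column_compatible_def by auto
  show ?case unfolding column_compatible_def
  proof (intro allI impI, elim conjE)
    fix i j
    assume ij: "1 \<le> i" "i < j" "j + c \<le> n + 1" "q (W i c) < q (W j c)"
    have ne: "W i c \<noteq> W j c" using ij by auto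
    show "p (W i c) < p (W j c)"
    proof (cases "W i c = \<omega> c")
      case True
      have x: "W i c = S 0 c" using True S0 c by simp
      show ?thesis
      \<comment> \<open>A contact or the elbow in row \<open>j\<close> makes \<open>W j c\<close>
        the carried pipe. A crossing leaves it in its row, and the next column compares it with the
        carried pipe \<open>S j c\<close>.\<close>
      proof (cases "crossing j c")
        case True
        then have b: "j + c \<le> n" by (simp add: crossing_def)
        have pz: "p (W i c) \<le> p (S j c)" using p_S_mono[of c 0 j] lin c b x by simp
        obtain k where k: "k < j" "W k (Suc c) = S j c" using crossing_swaps(1)[OF True] by blast
        have y: "W j (Suc c) = W j c" using crossing_swaps(2)[OF True] .
        obtain h where h: "j < h" "h + c \<le> n + 1" "S j c = W h c" using S_from c b by blast
        have "k \<noteq> 0"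
        proof
          assume "k = 0"
          then have "W i c = W h c" using k h x W_top[of c] c by simp
          then show False using W_eq_iff[of c i h] ij h c by auto
        qed
        moreover have "q (S j c) < q (W j c)" using ord True by (simp add: ordered_crossings_def)
        ultimately have "p (S j c) < p (W j c)" using IH[of k j] k y b by auto
        then show ?thesis using pz by simp
      next
        case False
        have "S (j - 1) c = W j c"
        proof (cases "j + c \<le> n")
          case True
          then show ?thesis using S_step[of "j - 1" c] False c ij by simp
        next
          case False
          then show ?thesis using S_last[of "j - 1" c] ij by simp
        qed
        then have "p (W i c) \<le> p (W j c)" using p_S_mono[of c 0 "j - 1"] lin c ij x by simp
        then show ?thesis using inj_p ne by (metis le_neq_implies_less)
      qed
    next
      case False
      \<comment> \<open>Both pipes exit to the right of \<open>c\<close>, so they reach the next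
        column. They keep their order, because the crossing needed to reverse it is excluded by
        \<open>ordered_crossings\<close>.\<close>
      obtain s where s: "s + c \<le> n" "W i c = W s (Suc c)" using W_to[of c i] ij c by auto
      obtain s' where s': "s' + c \<le> n" "W j c = W s' (Suc c)" using W_to[of c j] ij c by auto
      have "s \<noteq> 0" using s False S0[of c] W_top[of c] c by (metis)
      have "c \<le> q (W i c)" using W_label(1)[of c i] S0 c ij by auto
      then have "W j c \<noteq> \<omega> c" using ij q_\<omega>[of c] by auto
      then have "s' \<noteq> 0" using s' S0[of c] W_top[of c] c by metis
      have "s < s'"
      proof (rule ccontr)
        assume "\<not> s < s'"
        then have "s' < s" using s s' ne by (metis linorder_neqE_nat)
        then have "crossing s c \<and> W s c = W i c \<and> S s c = W j c"
          using order_step[of c s' s j i] s s' ij c by auto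
        then show False using ord ij unfolding ordered_crossings_def by fastforce
      qed
      then show ?thesis using IH[of s s'] \<open>s \<noteq> 0\<close> s s' ij by simp
    qed
  qed
qed

text \<open>After a crossing the southern pipe either leaves at the top, hence is
  \<open>\<omega> c\<close>, or enters the next column above the western pipe, where compatibility
  compares the two. After a contact it is in row \<open>r\<close>, not at the top, so it is not
  \<open>\<omega> c\<close>.\<close>

lemma extends_imp_greedy:
  assumes ex: "exits" and ord: "ordered_crossings" and lin: "extends"
  shows "greedy"
  unfolding greedy_def
proof (intro allI impI, elim conjE)
  fix r c
  assume b: "1 \<le> r" "1 \<le> c" "r + c \<le> n"
  have S0: "S 0 c = \<omega> c" using ex b by (simp add: exits_def)
  show "crossing r c \<longleftrightarrow> S r c = \<omega> c \<or> p (S r c) < p (W r c)"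
  proof (cases "crossing r c")
    case True
    obtain k where k: "k < r" "W k (Suc c) = S r c" using crossing_swaps(1)[OF True] by blast
    have y: "W r (Suc c) = W r c" using crossing_swaps(2)[OF True] .
    have q: "q (S r c) < q (W r c)" using ord True by (simp add: ordered_crossings_def)
    have "column_compatible (Suc c)" using extends_imp_column_compatible ex ord lin b by simp
    then have "p (S r c) < p (W r c)" if "k \<noteq> 0"
      using column_compatibleD[of "Suc c" k r] k y q that b by simp
    moreover have "S r c = \<omega> c" if "k = 0" using that k W_top S0 b by simp
    ultimately show ?thesis using True by blast
  next
    case False
    then have con: "contact r c" using b by (simp add: contact_def crossing_def)
    have "W r (Suc c) = S r c" using False b W_Suc[of c r] by (simp add: crossing_def)
    then have "S r c \<noteq> \<omega> c"
      using W_Suc_eq_iff[of c r 0] W_top[of c] S0 b by auto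
    then show ?thesis using con False lin by (force simp: extends_def)
  qed
qed

text \<open>A carried pipe that meets \<open>\<omega> c\<close> entered below it and has a later
  exit. Compatibility then puts it after \<open>\<omega> c\<close> in \<open>p\<close>, and the rule
  yields a contact. From there on \<open>\<omega> c\<close> is carried and crosses every pipe up to
  the top.\<close>

lemma greedy_exit_step:
  assumes gr: "greedy" and c: "1 \<le> c" "c \<le> n"
    and S0: "\<And>d. 1 \<le> d \<Longrightarrow> d < c \<Longrightarrow> S 0 d = \<omega> d" and comp: "column_compatible c"
  shows "S 0 c = \<omega> c"
proof -
  obtain i where i: "1 \<le> i" "i + c \<le> n + 1" "W i c = \<omega> c"
    by (rule W_at[of c c]) (use S0 c in auto)
  have first: "S (i - 1) c = \<omega> c"
  proof (cases "i + c \<le> n")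
    case True
    obtain h where h: "i < h" "h + c \<le> n + 1" "S i c = W h c" using S_from[of c i] c True by blast
    then have ne: "S i c \<noteq> \<omega> c" using W_eq_iff[of c i h] i c by auto
    have "c \<le> q (W h c)" "\<omega> (q (W h c)) = W h c"
      using W_label[of c h] S0 c h by auto
    then have "q (W i c) < q (W h c)" using ne h i q_\<omega> by (metis le_neq_implies_less)
    then have "p (W i c) < p (S i c)" using column_compatibleD[OF comp, of i h] h i by simp
    then have "\<not> crossing i c" using gr ne True i c unfolding greedy_def by auto
    then show ?thesis using S_step[of "i - 1" c] i c True by simp
  next
    case False
    then show ?thesis using S_last[of "i - 1" c] i by simp
  qed
  have "0 \<le> i - 1" by simp
  then show ?thesis
  proof (induction rule: inc_induct)
    case base
    show ?case by (rule first)
  next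
    case (step k)
    then have "crossing (Suc k) c" using gr i c unfolding greedy_def by auto
    then show ?case using S_step[of k c] step i c by simp
  qed
qed

text \<open>Both parts have to advance together: the exit at \<open>c\<close> needs compatibility of
  column \<open>c\<close>, and knowing that exit shows that a crossing of two pipes that stay in the
  grid is due to the comparison in \<open>p\<close>.\<close>

lemma greedy_invariant:
  assumes gr: "greedy" and comp: "column_compatible 1" and c: "1 \<le> c" "c \<le> Suc n"
  shows "column_compatible c \<and> (\<forall>d. 1 \<le> d \<and> d < c \<longrightarrow> S 0 d = \<omega> d)"
  using c
proof (induction c rule: dec_induct)
  case base
  then show ?case using comp by simp
next
  case (step c)
  then have IH: "column_compatible c" "\<And>d. 1 \<le> d \<Longrightarrow> d < c \<Longrightarrow> S 0 d = \<omega> d"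
    and c: "1 \<le> c" "c \<le> n" by auto
  have S0c: "S 0 c = \<omega> c" using greedy_exit_step gr c IH by blast
  have "column_compatible (Suc c)"
    unfolding column_compatible_def
  proof (intro allI impI, elim conjE)
    fix s s'
    assume ss: "1 \<le> s" "s < s'" "s' + Suc c \<le> n + 1" "q (W s (Suc c)) < q (W s' (Suc c))"
    obtain i where i: "1 \<le> i" "i + c \<le> n + 1" "W s (Suc c) = W i c"
      using W_Suc_from[of c s] c ss by auto
    obtain j where j: "1 \<le> j" "j + c \<le> n + 1" "W s' (Suc c) = W j c"
      using W_Suc_from[of c s'] c ss by auto
    have "i < j \<or> crossing s' c \<and> W s' c = W s' (Suc c) \<and> S s' c = W s (Suc c)"
      using order_step[of c s s' i j] ss i j c by auto
    then show "p (W s (Suc c)) < p (W s' (Suc c))"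
    proof
      assume "i < j"
      then show ?thesis using column_compatibleD[OF IH(1), of i j] i j ss by simp
    next
      assume cr: "crossing s' c \<and> W s' c = W s' (Suc c) \<and> S s' c = W s (Suc c)"
      have "W s (Suc c) \<noteq> \<omega> c"
        using W_Suc_eq_iff[of c s 0] W_top[of c] S0c c ss by auto
      then show ?thesis using cr gr ss c unfolding greedy_def by auto
    qed
  qed
  then show ?case using IH S0c by (auto simp: less_Suc_eq)
qed

lemma greedy_imp_exits:
  "greedy \<Longrightarrow> column_compatible 1 \<Longrightarrow> exits"
  using greedy_invariant[of "Suc n"] by (auto simp: exits_def)

lemma greedy_imp_extends: "greedy \<Longrightarrow> extends"
  unfolding extends_def
proof (intro allI impI)
  fix r c
  assume gr: "greedy" and con: "contact r c"
  then have b: "1 \<le> r" "1 \<le> c" "r + c \<le> n" and "\<not> crossing r c"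
    by (auto simp: contact_def crossing_def)
  then have "\<not> p (S r c) < p (W r c)" using gr unfolding greedy_def by auto
  moreover have "W r c \<noteq> S r c" using W_neq_S b by auto
  ultimately show "p (W r c) < p (S r c)" using inj_p by (metis linorder_neqE_nat)
qed

text \<open>If the southern pipe is \<open>\<omega> c\<close>, it exits first among the pipes of the
  column. Otherwise it precedes the western pipe in \<open>p\<close> although it entered below, and
  compatibility rules out a later exit.\<close>

lemma greedy_imp_ordered_crossings:
  assumes gr: "greedy" and comp: "column_compatible 1"
  shows "ordered_crossings"
  unfolding ordered_crossings_def
proof (intro allI impI)
  fix r c
  assume cr: "crossing r c"
  then have b: "1 \<le> r" "1 \<le> c" "r + c \<le> n" by (auto simp: crossing_def)
  have S0: "\<And>d. 1 \<le> d \<Longrightarrow> d < c \<Longrightarrow> S 0 d = \<omega> d" and cc: "column_compatible c"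
    using greedy_invariant[OF gr comp, of c] b by auto
  obtain i where i: "r < i" "i + c \<le> n + 1" "S r c = W i c" using S_from b by blast
  have y: "c \<le> q (W r c)" "\<omega> (q (W r c)) = W r c" using W_label[of c r] S0 b by auto
  have x: "\<omega> (q (S r c)) = S r c" using W_label[of c i] S0 b i by auto
  have ne: "q (S r c) \<noteq> q (W r c)" using x y W_neq_S[of c r] b by auto
  have "S r c = \<omega> c \<or> p (S r c) < p (W r c)" using gr cr b unfolding greedy_def by auto
  then show "q (S r c) < q (W r c)"
  proof
    assume "S r c = \<omega> c"
    then show ?thesis using y ne q_\<omega>[of c] by simp
  next
    assume "p (S r c) < p (W r c)"
    then have "\<not> q (W r c) < q (S r c)"
      using column_compatibleD[OF cc, of r i] i b by auto
    then show ?thesis using ne by simp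
  qed
qed

text \<open>The left side will mean an element of \<open>PD n \<omega>\<close> with linear extension
  \<open>\<pi>\<close>, the right side the greedy filling together with \<open>\<pi>\<close> being
  below \<open>\<omega>\<close>.\<close>

lemma exits_extends_iff_greedy:
  "exits \<and> single_crossings \<and> extends \<longleftrightarrow> greedy \<and> column_compatible 1"
  using ordered_crossings_imp_single_crossings single_crossings_imp_ordered_crossings
    extends_imp_column_compatible[of 1] extends_imp_greedy greedy_imp_exits greedy_imp_extends
    greedy_imp_ordered_crossings by (metis One_nat_def Suc_le_mono le0 order_refl)

end

section \<open>Pipe dreams\<close>

abbreviation in_range :: "nat \<Rightarrow> side \<Rightarrow> nat \<Rightarrow> nat \<Rightarrow> bool" where
  "in_range n s r c \<equiv> 1 \<le> c \<and> (case s of West \<Rightarrow> 1 \<le> r \<and> r + c \<le> n + 1 | South \<Rightarrow> r + c \<le> n)"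

text \<open>The rules need to agree only on the pairs of pipes that the first one produces. This
  allows a rule that looks at the pipes to be exchanged for its set of crossings.\<close>

lemma pipe_cong:
  assumes "\<And>r c. 1 \<le> r \<Longrightarrow> 1 \<le> c \<Longrightarrow> r + c \<le> n \<Longrightarrow>
      X r c (pipe n X West r c) (pipe n X South r c) = Y r c (pipe n X West r c) (pipe n X South r c)"
    and "in_range n s r c"
  shows "pipe n X s r c = pipe n Y s r c"
  using assms
proof (induction n X s r c rule: pipe.induct)
  case (1 n X r c)
  show ?case
  proof (cases "c \<le> 1")
    case True
    then show ?thesis by (simp add: pipe.simps)
  next
    case False
    then have b: "1 \<le> r" "1 \<le> c - 1" "r + (c - 1) \<le> n" using "1.prems"(2) by auto
    have "pipe n X West r (c - 1) = pipe n Y West r (c - 1)"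
      by (rule "1.IH"(2)) (use False b "1.prems"(1) in auto)
    moreover have "pipe n X South r (c - 1) = pipe n Y South r (c - 1)"
      by (rule "1.IH"(3)) (use False b "1.prems"(1) in auto)
    ultimately show ?thesis
      using False b "1.prems"(1)[OF b] by (simp add: pipe.simps(1)[of n _ r c])
  qed
next
  case (2 n X r c)
  show ?case
  proof (cases "n \<le> r + c")
    case True
    then have "pipe n X West (Suc r) c = pipe n Y West (Suc r) c"
      by (intro "2.IH"(1)) (use "2.prems" in auto)
    then show ?thesis using True by (simp add: pipe.simps(2)[of n _ r c])
  next
    case False
    then have b: "1 \<le> Suc r" "1 \<le> c" "Suc r + c \<le> n" using "2.prems"(2) by auto
    have "pipe n X West (Suc r) c = pipe n Y West (Suc r) c"
      by (rule "2.IH"(2)) (use False b "2.prems"(1) in auto)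
    moreover have "pipe n X South (Suc r) c = pipe n Y South (Suc r) c"
      by (rule "2.IH"(3)) (use False b "2.prems"(1) in auto)
    ultimately show ?thesis
      using False "2.prems"(1)[OF b] by (simp add: pipe.simps(2)[of n _ r c])
  qed
qed

section \<open>The inductive pipes as traced pipes\<close>

abbreviation crossing_set_rule :: "(nat \<times> nat) set \<Rightarrow> nat \<Rightarrow> nat \<Rightarrow> nat \<Rightarrow> nat \<Rightarrow> bool" where
  "crossing_set_rule C \<equiv> \<lambda>r c w s. (r, c) \<in> C"

lemma enters_imp_pipe:
  assumes "C \<subseteq> inner_positions n" "enters n C j s r c"
  shows "in_range n s r c \<and> pipe n (crossing_set_rule C) s r c = j"
  using assms(2)
proof (induction rule: enters.induct)
  case start
  then show ?case by (auto simp: pipe.simps)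
next
  case (cross_east r c)
  then have "(r, c) \<in> inner_positions n" using assms(1) by blast
  then show ?case using cross_east by (auto simp: inner_positions_def pipe.simps(1)[of _ _ r "Suc c"])
next
  case (cross_north r c)
  then have "(Suc r, c) \<in> inner_positions n" using assms(1) by blast
  then show ?case using cross_north by (auto simp: inner_positions_def pipe.simps(2)[of _ _ r c])
next
  case (turn_north r c)
  then show ?case using assms(1)
    by (auto simp: contacts_def elbows_def inner_positions_def pipe.simps(2)[of _ _ r c])
next
  case (turn_east r c)
  then show ?case
    by (auto simp: contacts_def inner_positions_def pipe.simps(1)[of _ _ r "Suc c"])
qed

lemma pipe_enters:
  "in_range n s r c \<Longrightarrow> enters n C (pipe n (crossing_set_rule C) s r c) s r c"
proof (induction n "crossing_set_rule C" s r c rule: pipe.induct)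
  case (1 n r c)
  show ?case
  proof (cases "c \<le> 1")
    case True
    then have "c = 1" using 1 by auto
    then show ?thesis using 1 enters.start[of r n C] by (auto simp: pipe.simps(1)[of n _ r "Suc 0"])
  next
    case False
    then obtain c' where c: "c = Suc c'" "1 \<le> c'" by (cases c) auto
    have b: "1 \<le> r" "r + c' \<le> n" using "1.prems" c by auto
    have "enters n C (pipe n (crossing_set_rule C) West r c') West r c'"
      and "enters n C (pipe n (crossing_set_rule C) South r c') South r c'"
      using "1.hyps"(2,3) c b by auto
    then show ?thesis using c b
      by (auto simp: pipe.simps(1)[of n _ r "Suc c'"] contacts_def inner_positions_def
          intro: enters.cross_east enters.turn_east)
  qed
next
  case (2 n r c)
  show ?case
  proof (cases "n \<le> r + c")
    case True
    then have "enters n C (pipe n (crossing_set_rule C) West (Suc r) c) West (Suc r) c"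
      using "2.hyps"(1) "2.prems" by auto
    moreover have "(Suc r, c) \<in> elbows n" using True "2.prems" by (auto simp: elbows_def)
    ultimately show ?thesis using True
      by (auto simp: pipe.simps(2)[of n _ r c] intro: enters.turn_north)
  next
    case False
    have "enters n C (pipe n (crossing_set_rule C) West (Suc r) c) West (Suc r) c"
      and "enters n C (pipe n (crossing_set_rule C) South (Suc r) c) South (Suc r) c"
      using "2.hyps"(2,3) "2.prems" False by auto
    then show ?thesis using False "2.prems"
      by (auto simp: pipe.simps(2)[of n _ r c] contacts_def inner_positions_def
          intro: enters.cross_north enters.turn_north)
  qed
qed

lemma enters_iff:
  assumes "C \<subseteq> inner_positions n"
  shows "enters n C j s r c \<longleftrightarrow> in_range n s r c \<and> pipe n (crossing_set_rule C) s r c = j"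
  using enters_imp_pipe[OF assms] pipe_enters by blast

lemma pipe_at_eq:
  assumes "C \<subseteq> inner_positions n" "in_range n s r c"
  shows "pipe_at n C s (r, c) = pipe n (crossing_set_rule C) s r c"
  using assms(2) unfolding pipe_at_def by (simp add: enters_iff[OF assms(1)] the_equality)

lemma enters_label: "enters n C j s r c \<Longrightarrow> j \<in> {1..n}"
  by (induction rule: enters.induct)

lemma pipe_in_labels: "in_range n s r c \<Longrightarrow> pipe n (crossing_set_rule C) s r c \<in> {1..n}"
  using enters_label[OF pipe_enters] .

section \<open>Translation of pipe dreams, contact graphs and the weak order\<close>

locale pipe_dream_setup =
  fixes n :: nat and \<omega> :: "nat \<Rightarrow> nat"
  assumes \<omega>: "\<omega> permutes {1..n}"
begin

lemma target_rule: "target_rule n \<omega> (inv \<omega>)"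
  using \<omega> by unfold_locales (auto simp: permutes_inverses permutes_image)

lemma extension_rule:
  assumes "\<pi> permutes {1..n}"
  shows "extension_rule n \<omega> (inv \<omega>) (inv \<pi>)"
proof -
  interpret target_rule n X \<omega> "inv \<omega>" for X by (rule target_rule)
  show ?thesis
    by unfold_locales (use permutes_inj[OF permutes_inv[OF assms]] in \<open>auto dest: injD\<close>)
qed

lemma cross_at_iff:
  assumes C: "C \<subseteq> inner_positions n"
  shows "cross_at n C i j (r, c) \<longleftrightarrow> pipe_rule.crossing n (crossing_set_rule C) r c \<and>
    {pipe n (crossing_set_rule C) West r c, pipe n (crossing_set_rule C) South r c} = {i, j}"
proof -
  have "1 \<le> r \<and> 1 \<le> c \<and> r + c \<le> n" if "(r, c) \<in> C"
    using that C by (auto simp: inner_positions_def)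
  then show ?thesis
    unfolding cross_at_def enters_iff[OF C] pipe_rule.crossing_def
    by (auto simp: doubleton_eq_iff)
qed

lemma PD_iff:
  assumes C: "C \<subseteq> inner_positions n"
  shows "C \<in> PD n \<omega> \<longleftrightarrow> target_rule.exits n (crossing_set_rule C) \<omega> \<and>
    target_rule.single_crossings n (crossing_set_rule C)"
proof -
  interpret target_rule n "crossing_set_rule C" \<omega> "inv \<omega>" by (rule target_rule)
  have "reduced n C \<longleftrightarrow> single_crossings"
    unfolding reduced_def single_crossings_def split_paired_All cross_at_iff[OF C] by metis
  moreover have "(\<forall>j\<in>{1..n}. exits_at n C j (inv \<omega> j)) \<longleftrightarrow> exits"
  proof
    assume L: "\<forall>j\<in>{1..n}. exits_at n C j (inv \<omega> j)"
    show "exits" unfolding exits_def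
    proof (intro allI impI)
      fix c assume "1 \<le> c \<and> c \<le> n"
      then have "\<omega> c \<in> {1..n}" using permutes_in_image[OF \<omega>] by simp
      then have "exits_at n C (\<omega> c) (inv \<omega> (\<omega> c))" using L by blast
      then show "S 0 c = \<omega> c" by (simp add: exits_at_def enters_iff[OF C] q_\<omega>)
    qed
  next
    assume R: "exits"
    show "\<forall>j\<in>{1..n}. exits_at n C j (inv \<omega> j)"
    proof
      fix j assume "j \<in> {1..n}"
      then have "inv \<omega> j \<in> {1..n}" using permutes_in_image[OF permutes_inv[OF \<omega>]] by simp
      then show "exits_at n C j (inv \<omega> j)"
        using R by (simp add: exits_at_def enters_iff[OF C] exits_def permutes_inverses[OF \<omega>])
    qed
  qed
  ultimately show ?thesis using C by (auto simp: PD_def)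
qed

lemma arcs_ends_contact_graph:
  assumes C: "C \<subseteq> inner_positions n"
  shows "arcs_ends (contact_graph n C) = {(pipe n (crossing_set_rule C) West r c,
    pipe n (crossing_set_rule C) South r c) | r c. pipe_rule.contact n (crossing_set_rule C) r c}"
proof -
  have "(\<lambda>e. (pipe_at n C West e, pipe_at n C South e)) ` contacts n C =
    (\<lambda>(r, c). (pipe n (crossing_set_rule C) West r c, pipe n (crossing_set_rule C) South r c)) ` contacts n C"
    by (intro image_cong refl) (auto simp: contacts_def inner_positions_def pipe_at_eq[OF C])
  moreover have "contacts n C = {(r, c). pipe_rule.contact n (crossing_set_rule C) r c}"
    by (auto simp: contacts_def inner_positions_def pipe_rule.contact_def)
  ultimately show ?thesis
    unfolding arcs_ends_conv contact_graph_def by (auto simp: image_iff)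
qed

lemma linear_extensions_iff:
  assumes "C \<subseteq> inner_positions n"
  shows "\<pi> \<in> linear_extensions n C \<longleftrightarrow>
    \<pi> permutes {1..n} \<and> extension_rule.extends n (crossing_set_rule C) (inv \<pi>)"
proof (cases "\<pi> permutes {1..n}")
  case True
  interpret extension_rule n "crossing_set_rule C" \<omega> "inv \<omega>" "inv \<pi>" by (rule extension_rule[OF True])
  show ?thesis
    unfolding linear_extensions_def arcs_ends_contact_graph[OF assms] extends_def by auto
qed (simp add: linear_extensions_def)

text \<open>Pipe \<open>r\<close> enters the first column in row \<open>r\<close>, whatever the rule
  \<open>X\<close>, so compatibility there is the contrapositive of the inclusion of
  inversions.\<close>

lemma weak_le_iff:
  assumes "\<pi> permutes {1..n}"
  shows "weak_le n \<pi> \<omega> \<longleftrightarrow> extension_rule.column_compatible n X (inv \<omega>) (inv \<pi>) 1"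
proof -
  interpret extension_rule n X \<omega> "inv \<omega>" "inv \<pi>" by (rule extension_rule[OF assms])
  have ne: "inv \<pi> i \<noteq> inv \<pi> j" "inv \<omega> i \<noteq> inv \<omega> j" if "i < j" for i j
    using that permutes_inverses(1)[OF assms] permutes_inverses(1)[OF \<omega>] by (metis less_irrefl)+
  have "weak_le n \<pi> \<omega> \<longleftrightarrow> (\<forall>i j. 1 \<le> i \<and> i < j \<and> j \<le> n \<longrightarrow> inv \<pi> j < inv \<pi> i \<longrightarrow> inv \<omega> j < inv \<omega> i)"
    unfolding weak_le_def inversions_def by (auto simp: subset_iff)
  also have "\<dots> \<longleftrightarrow> (\<forall>i j. 1 \<le> i \<and> i < j \<and> j \<le> n \<longrightarrow> inv \<omega> i < inv \<omega> j \<longrightarrow> inv \<pi> i < inv \<pi> j)"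
    using ne by (meson linorder_neqE_nat less_asym)
  also have "\<dots> \<longleftrightarrow> column_compatible 1"
    unfolding column_compatible_def using W_first by auto
  finally show ?thesis .
qed

text \<open>The greedy condition on a set of crossings refers to the pipes of that set. Tracing the pipes by
  the rule itself breaks this circularity.\<close>

definition greedy_rule :: "(nat \<Rightarrow> nat) \<Rightarrow> nat \<Rightarrow> nat \<Rightarrow> nat \<Rightarrow> nat \<Rightarrow> bool" where
  "greedy_rule \<pi> r c w s \<longleftrightarrow> s = \<omega> c \<or> inv \<pi> s < inv \<pi> w"

definition greedy_crossings :: "(nat \<Rightarrow> nat) \<Rightarrow> (nat \<times> nat) set" where
  "greedy_crossings \<pi> = {(r, c). (r, c) \<in> inner_positions n \<and>
     greedy_rule \<pi> r c (pipe n (greedy_rule \<pi>) West r c) (pipe n (greedy_rule \<pi>) South r c)}"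

text \<open>Existence and uniqueness of the greedy filling. In either direction membership and rule
  agree on the pipes traced by one of them, so by \<open>pipe_cong\<close> both trace the same
  pipes.\<close>

lemma greedy_iff:
  assumes \<pi>: "\<pi> permutes {1..n}" and C: "C \<subseteq> inner_positions n"
  shows "extension_rule.greedy n (crossing_set_rule C) \<omega> (inv \<pi>) \<longleftrightarrow> C = greedy_crossings \<pi>"
proof -
  interpret extension_rule n "crossing_set_rule C" \<omega> "inv \<omega>" "inv \<pi>" by (rule extension_rule[OF \<pi>])
  have greedy: "greedy \<longleftrightarrow> (\<forall>r c. 1 \<le> r \<and> 1 \<le> c \<and> r + c \<le> n \<longrightarrow>
      ((r, c) \<in> C \<longleftrightarrow> greedy_rule \<pi> r c (W r c) (S r c)))"
    unfolding greedy_def crossing_def greedy_rule_def by auto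
  show ?thesis
  proof
    assume gr: "greedy"
    have eq: "pipe n (crossing_set_rule C) s r c = pipe n (greedy_rule \<pi>) s r c"
      if "in_range n s r c" for s r c
      by (rule pipe_cong) (use gr greedy that in auto)
    have "(r, c) \<in> C \<longleftrightarrow> (r, c) \<in> greedy_crossings \<pi>" if "1 \<le> r" "1 \<le> c" "r + c \<le> n" for r c
      using gr that eq[where s = West and r = r and c = c] eq[where s = South and r = r and c = c]
      unfolding greedy greedy_crossings_def inner_positions_def by auto
    then show "C = greedy_crossings \<pi>"
      using C by (auto simp: greedy_crossings_def inner_positions_def)
  next
    assume C_eq: "C = greedy_crossings \<pi>"
    have eq: "pipe n (greedy_rule \<pi>) s r c = pipe n (crossing_set_rule C) s r c"
      if "in_range n s r c" for s r c
      by (rule pipe_cong) (use that in \<open>auto simp: C_eq greedy_crossings_def inner_positions_def\<close>)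
    show "greedy" unfolding greedy
    proof (intro allI impI)
      fix r c assume "1 \<le> r \<and> 1 \<le> c \<and> r + c \<le> n"
      then show "(r, c) \<in> C \<longleftrightarrow> greedy_rule \<pi> r c (W r c) (S r c)"
        using eq[where s = West and r = r and c = c] eq[where s = South and r = r and c = c]
        by (subst C_eq) (auto simp: greedy_crossings_def inner_positions_def)
    qed
  qed
qed

text \<open>Each \<open>\<pi>\<close> has a single candidate pipe dream, which makes the sets of
  linear extensions disjoint; that the candidate works on the whole interval makes them cover
  it.\<close>

lemma PD_linear_extension_iff:
  "C \<in> PD n \<omega> \<and> \<pi> \<in> linear_extensions n C \<longleftrightarrow>
    \<pi> \<in> weak_lower_interval n \<omega> \<and> C = greedy_crossings \<pi>"
proof (cases "\<pi> permutes {1..n} \<and> C \<subseteq> inner_positions n")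
  case True
  interpret extension_rule n "crossing_set_rule C" \<omega> "inv \<omega>" "inv \<pi>"
    using extension_rule True by blast
  have C: "C \<subseteq> inner_positions n" using True ..
  show ?thesis
    using True exits_extends_iff_greedy greedy_iff[of \<pi> C] weak_le_iff[of \<pi> "crossing_set_rule C"]
    unfolding PD_iff[OF C] linear_extensions_iff[OF C] weak_lower_interval_def by blast
next
  case False
  have "greedy_crossings \<pi> \<subseteq> inner_positions n" by (auto simp: greedy_crossings_def)
  then show ?thesis using False by (auto simp: linear_extensions_def PD_def weak_lower_interval_def)
qed

end

section \<open>Topological sorting\<close>

lemma acyclic_imp_sorted_list:
  assumes "finite A" "acyclic R"
  shows "\<exists>xs. set xs = A \<and> distinct xs \<and> (\<forall>i<length xs. \<forall>j<length xs. (xs ! i, xs ! j) \<in> R \<longrightarrow> i < j)"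
  using assms(1)
proof (induction "card A" arbitrary: A)
  case 0
  then show ?case by auto
next
  case (Suc k)
  define R' where "R' = Restr R A"
  have "acyclic R'" using assms(2) by (rule acyclic_subset) (auto simp: R'_def)
  moreover have "finite R'" using Suc.prems by (simp add: R'_def)
  ultimately have "wf R'" by (simp add: finite_acyclic_wf)
  moreover obtain a where "a \<in> A" using Suc.hyps(2) by fastforce
  \<comment> \<open>A finite acyclic relation is well-founded, so some \<open>x\<close> has no
    predecessor in \<open>A\<close>; it becomes the head of the list.\<close>
  ultimately obtain x where x: "x \<in> A" "\<And>y. (y, x) \<in> R' \<Longrightarrow> y \<notin> A"
    using wfE_min[of R' a A] by metis
  have k: "k = card (A - {x})" using Suc.hyps(2) x(1) by (metis card_Diff_singleton diff_Suc_1)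
  have fin: "finite (A - {x})" using Suc.prems by simp
  obtain xs where xs: "set xs = A - {x}" "distinct xs"
    "\<forall>i<length xs. \<forall>j<length xs. (xs ! i, xs ! j) \<in> R \<longrightarrow> i < j"
    using Suc.hyps(1)[OF k fin] by blast
  have set_eq: "set (x # xs) = A"
    unfolding list.set(2) xs(1) using x(1) by blast
  have "i < j" if "i < length (x # xs)" "j < length (x # xs)" "((x # xs) ! i, (x # xs) ! j) \<in> R" for i j
  proof (cases j)
    case 0
    have A: "(x # xs) ! i \<in> A" using nth_mem[OF that(1)] unfolding set_eq .
    moreover have "((x # xs) ! i, x) \<in> R" using that(3) 0 by simp
    ultimately have "((x # xs) ! i, x) \<in> R'" using x(1) unfolding R'_def by blast
    then show ?thesis using x(2) A by blast
  next
    case (Suc j')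
    then show ?thesis using that xs(3) by (cases i) auto
  qed
  moreover have "distinct (x # xs)" using xs by simp
  ultimately show ?case using set_eq by blast
qed

lemma acyclic_imp_linear_extension:
  assumes "acyclic R"
  obtains \<pi> where "\<pi> permutes {1..n}"
    "\<And>i j. (i, j) \<in> R \<Longrightarrow> i \<in> {1..n} \<Longrightarrow> j \<in> {1..n} \<Longrightarrow> inv \<pi> i < inv \<pi> (j :: nat)"
proof -
  obtain xs where xs: "set xs = {1..n}" "distinct xs"
    "\<forall>i<length xs. \<forall>j<length xs. (xs ! i, xs ! j) \<in> R \<longrightarrow> i < j"
    using acyclic_imp_sorted_list[OF _ assms, of "{1..n}"] by auto
  have len: "length xs = n" using distinct_card[OF xs(2)] xs(1) by simp
  \<comment> \<open>Lists count from 0 and permutations from 1; outside \<open>{1..n}\<close> the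
    value is the identity, as \<open>permutes\<close> demands.\<close>
  define \<pi> where "\<pi> i = (if i \<in> {1..n} then xs ! (i - 1) else i)" for i
  have "inj_on \<pi> {1..n}"
    using xs(2) len by (auto simp: inj_on_def \<pi>_def nth_eq_iff_index_eq)
  moreover have "\<pi> ` {1..n} \<subseteq> {1..n}"
  proof
    fix y assume "y \<in> \<pi> ` {1..n}"
    then obtain i where "i \<in> {1..n}" "y = xs ! (i - 1)" by (auto simp: \<pi>_def)
    then show "y \<in> {1..n}" using nth_mem[of "i - 1" xs] xs(1) len by auto
  qed
  ultimately have "bij_betw \<pi> {1..n} {1..n}"
    by (simp add: bij_betw_def endo_inj_surj)
  then have perm: "\<pi> permutes {1..n}" by (rule bij_imp_permutes) (auto simp: \<pi>_def)
  have "inv \<pi> i < inv \<pi> j" if ij: "(i, j) \<in> R" "i \<in> {1..n}" "j \<in> {1..n}" for i j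
  proof -
    have r: "inv \<pi> i \<in> {1..n}" "inv \<pi> j \<in> {1..n}"
      using ij permutes_in_image[OF permutes_inv[OF perm]] by auto
    have "xs ! (inv \<pi> x - 1) = x" if "inv \<pi> x \<in> {1..n}" for x
      using trans[OF \<pi>_def if_P[OF that]] permutes_inverses(1)[OF perm, of x] by simp
    then have "xs ! (inv \<pi> i - 1) = i" "xs ! (inv \<pi> j - 1) = j" using r by auto
    then have "inv \<pi> i - 1 < inv \<pi> j - 1" using xs(3) ij(1) r len by auto
    then show ?thesis by simp
  qed
  then show ?thesis using that perm by blast
qed

section \<open>Acyclicity of the contact graph\<close>

context pipe_dream_setup
begin

text \<open>Passing from arcs to pairs of ends forgets multiplicities but keeps closed walks, and
  every nonempty closed walk contains a cycle.\<close>

lemma cyclic_iff: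
  assumes C: "C \<subseteq> inner_positions n"
  shows "(\<exists>p. pre_digraph.cycle (contact_graph n C) p) \<longleftrightarrow> \<not> acyclic (arcs_ends (contact_graph n C))"
proof -
  interpret wf_digraph "contact_graph n C"
    using pipe_in_labels pipe_at_eq[OF C]
    by unfold_locales (auto simp: contact_graph_def contacts_def inner_positions_def)
  show ?thesis
  proof
    assume "\<exists>p. cycle p"
    then obtain p u where "awalk u p u" "p \<noteq> []" unfolding cycle_def by blast
    then have "(u, u) \<in> (arcs_ends (contact_graph n C))\<^sup>+" by (rule reachable1_awalkI)
    then show "\<not> acyclic (arcs_ends (contact_graph n C))" by (auto simp: acyclic_def)
  next
    assume "\<not> acyclic (arcs_ends (contact_graph n C))"
    then obtain u where "(u, u) \<in> (arcs_ends (contact_graph n C))\<^sup>+" by (auto simp: acyclic_def)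
    then obtain p where "awalk u p u" "p \<noteq> []" unfolding reachable1_awalk by blast
    then have "closed_w p" by (auto simp: closed_w_def)
    then show "\<exists>p. cycle p" by (rule closed_w_imp_cycle)
  qed
qed

lemma acyclic_iff_linear_extensions_nonempty:
  assumes C: "C \<subseteq> inner_positions n"
  shows "acyclic (arcs_ends (contact_graph n C)) \<longleftrightarrow> linear_extensions n C \<noteq> {}"
proof
  assume "acyclic (arcs_ends (contact_graph n C))"
  then obtain \<pi> where \<pi>: "\<pi> permutes {1..n}" "\<And>i j. (i, j) \<in> arcs_ends (contact_graph n C) \<Longrightarrow>
      i \<in> {1..n} \<Longrightarrow> j \<in> {1..n} \<Longrightarrow> inv \<pi> i < inv \<pi> j"
    using acyclic_imp_linear_extension by blast
  moreover have "i \<in> {1..n} \<and> j \<in> {1..n}" if "(i, j) \<in> arcs_ends (contact_graph n C)" for i j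
    using that pipe_in_labels[where s = West] pipe_in_labels[where s = South]
    unfolding arcs_ends_contact_graph[OF C] pipe_rule.contact_def by force
  ultimately have "\<pi> \<in> linear_extensions n C" unfolding linear_extensions_def by blast
  then show "linear_extensions n C \<noteq> {}" by blast
next
  assume "linear_extensions n C \<noteq> {}"
  then obtain \<pi> where "\<pi> \<in> linear_extensions n C" by blast
  then have "arcs_ends (contact_graph n C) \<subseteq> inv_image less_than (inv \<pi>)"
    by (auto simp: linear_extensions_def)
  then show "acyclic (arcs_ends (contact_graph n C))"
    by (meson acyclic_subset wf_acyclic wf_inv_image wf_less_than)
qed

text \<open>With this form, acyclicity of the greedy pipe dream is immediate from its linear
  extension \<open>\<pi>\<close>.\<close>

lemma APD_iff: "C \<in> APD n \<omega> \<longleftrightarrow> C \<in> PD n \<omega> \<and> linear_extensions n C \<noteq> {}"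
proof (cases "C \<in> PD n \<omega>")
  case True
  then have C: "C \<subseteq> inner_positions n" by (simp add: PD_def)
  show ?thesis
    unfolding APD_def mem_Collect_eq cyclic_iff[OF C] not_not
      acyclic_iff_linear_extensions_nonempty[OF C] ..
qed (simp add: APD_def)

end

theorem theorem3p2:
  fixes n :: nat and \<omega> :: "nat \<Rightarrow> nat"
  assumes "n \<ge> 1" and "\<omega> permutes {1..n}"
  shows "(\<forall>P\<in>APD n \<omega>. linear_extensions n P \<noteq> {}) \<and>
    (\<forall>P\<in>APD n \<omega>. \<forall>Q\<in>APD n \<omega>. P \<noteq> Q \<longrightarrow> linear_extensions n P \<inter> linear_extensions n Q = {}) \<and>
    (\<Union>P\<in>APD n \<omega>. linear_extensions n P) = weak_lower_interval n \<omega> \<and>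
    partition_on (weak_lower_interval n \<omega>) (linear_extensions n ` APD n \<omega>)"
proof -
  interpret pipe_dream_setup n \<omega> using assms(2) by unfold_locales
  have nonempty: "\<forall>P\<in>APD n \<omega>. linear_extensions n P \<noteq> {}" by (simp add: APD_iff)
  have disjoint: "P = Q" if "P \<in> APD n \<omega>" "Q \<in> APD n \<omega>"
    "\<pi> \<in> linear_extensions n P" "\<pi> \<in> linear_extensions n Q" for P Q \<pi>
    using that PD_linear_extension_iff unfolding APD_iff by metis
  have union: "(\<Union>P\<in>APD n \<omega>. linear_extensions n P) = weak_lower_interval n \<omega>"
  proof (intro equalityI subsetI)
    fix \<pi> assume "\<pi> \<in> (\<Union>P\<in>APD n \<omega>. linear_extensions n P)"
    then obtain P where "P \<in> PD n \<omega>" "\<pi> \<in> linear_extensions n P" by (auto simp: APD_iff)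
    then show "\<pi> \<in> weak_lower_interval n \<omega>" using PD_linear_extension_iff by blast
  next
    fix \<pi> assume "\<pi> \<in> weak_lower_interval n \<omega>"
    then have "greedy_crossings \<pi> \<in> PD n \<omega>" "\<pi> \<in> linear_extensions n (greedy_crossings \<pi>)"
      using PD_linear_extension_iff by blast+
    moreover from this have "greedy_crossings \<pi> \<in> APD n \<omega>" unfolding APD_iff by blast
    ultimately show "\<pi> \<in> (\<Union>P\<in>APD n \<omega>. linear_extensions n P)" by blast
  qed
  have "partition_on (weak_lower_interval n \<omega>) (linear_extensions n ` APD n \<omega>)"
    using nonempty union disjoint unfolding partition_on_def disjoint_def by fast
  then show ?thesis using nonempty disjoint union by blast
qed

end
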